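(* Let $(\mathbb{B},\|\cdot\|)$ be a normed space, let $(x_n)_{n\in\mathbb{N}}$ be a sequence in $\mathbb{B}$ and let $(a_n)$ be real numbers with $0<a_0\le a_1\le\cdots$ and $a_n\to\infty$. For $n\in\mathbb{N}$ and $x\ge 0$ put $s_n:=\sum_{i=0}^n x_i$ and $f(x):=\min\{n\in\mathbb{N}: a_n\ge x\}$. Let $\gamma:\mathbb{Q}^+\to\mathbb{N}$, let $(z_n)$ be a sequence of natural numbers, let $\varepsilon\in\mathbb{Q}^+$ and $w\in\mathbb{N}$, and set $M:=\gamma(\varepsilon/4)$. Suppose that $z_M\ge\|s_i\|$ for all $i\le M$, and that $\|s_n-s_M\|<\varepsilon/4$ for all $n\in[M;w]$. Then, with $$N:=\max\left\{\gamma\left(\tfrac{\varepsilon}{4}\right),\ f\left(\frac{4a_{\gamma(\varepsilon/4)}z_{\gamma(\varepsilon/4)}}{\varepsilon}\right)\right\},$$ we have $\left\|\frac{1}{a_n}\sum_{i=0}^n a_ix_i\right\|<\varepsilon$ for all $n\in[N;w]$.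
   Context: For natural numbers $a,b$, $[a;b]:=\{a,a+1,\dots,b\}$ if $a\le b$ and $\emptyset$ otherwise. *)

theory Defs
  imports Complex_Main
begin

definition partial_sum :: "(nat \<Rightarrow> 'b::real_normed_vector) \<Rightarrow> nat \<Rightarrow> 'b" where
  "partial_sum x n = (\<Sum>i=0..n. x i)"

(* The least index n with a n \<ge> x; it exists for every x as soon as a tends to infinity. *)
definition first_index :: "(nat \<Rightarrow> real) \<Rightarrow> real \<Rightarrow> nat" where
  "first_index a x = (LEAST n. a n \<ge> x)"

definition kronecker_rate ::
    "(nat \<Rightarrow> real) \<Rightarrow> (rat \<Rightarrow> nat) \<Rightarrow> (nat \<Rightarrow> nat) \<Rightarrow> rat \<Rightarrow> nat" where
  "kronecker_rate a \<gamma> z \<epsilon> =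
     max (\<gamma> (\<epsilon> / 4))
         (first_index a (4 * a (\<gamma> (\<epsilon> / 4)) * real (z (\<gamma> (\<epsilon> / 4))) / real_of_rat \<epsilon>))"

end

theory Submission imports Defs
begin

text \<open>
  Summation by parts around \<open>M = \<gamma> (\<epsilon> / 4)\<close> writes the weighted sum up to \<open>n\<close> as the weighted sum up
  to \<open>M\<close> plus a remainder in which only the differences \<open>s\<^sub>i - s\<^sub>M\<close> with \<open>M \<le> i \<le> n\<close> occur. The
  former is at most \<open>2 a\<^sub>M z\<^sub>M\<close>, hence at most \<open>a\<^sub>n \<epsilon> / 2\<close> by the choice of \<open>f\<close>; the latter is less
  than \<open>a\<^sub>n \<epsilon> / 4 + (a\<^sub>n - a\<^sub>M) \<epsilon> / 4\<close>.
\<close>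

lemma partial_sum_Suc: "partial_sum x (Suc n) = partial_sum x n + x (Suc n)"
  by (simp add: partial_sum_def)

text \<open>Abel summation. It serves for the sum up to \<open>M\<close>, where the partial sums
  themselves are bounded.\<close>

lemma weighted_sum_by_parts:
  fixes x :: "nat \<Rightarrow> 'b::real_normed_vector" and a :: "nat \<Rightarrow> real"
  shows "(\<Sum>i=0..n. a i *\<^sub>R x i) =
    a n *\<^sub>R partial_sum x n - (\<Sum>i=0..<n. (a (Suc i) - a i) *\<^sub>R partial_sum x i)"
  by (induction n) (simp_all add: partial_sum_Suc algebra_simps, simp add: partial_sum_def)

text \<open>Both corrections vanish at \<open>n = m\<close>; passing to \<open>Suc n\<close>, the
  multiples of \<open>partial_sum x n - partial_sum x m\<close> cancel and
  \<open>a (Suc n) *\<^sub>R x (Suc n)\<close> remains.\<close>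

lemma weighted_sum_by_parts_from:
  fixes x :: "nat \<Rightarrow> 'b::real_normed_vector" and a :: "nat \<Rightarrow> real"
  assumes "m \<le> n"
  shows "(\<Sum>i=0..n. a i *\<^sub>R x i) = (\<Sum>i=0..m. a i *\<^sub>R x i)
    + a n *\<^sub>R (partial_sum x n - partial_sum x m)
    - (\<Sum>i=m..<n. (a (Suc i) - a i) *\<^sub>R (partial_sum x i - partial_sum x m))"
  using assms by (induction rule: dec_induct) (simp_all add: partial_sum_Suc algebra_simps)

text \<open>Monotonicity makes the weights nonnegative, and they telescope.\<close>

lemma norm_sum_increments_le:
  fixes y :: "nat \<Rightarrow> 'b::real_normed_vector" and a :: "nat \<Rightarrow> real"
  assumes "mono a" and "m \<le> n" and "\<And>i. m \<le> i \<Longrightarrow> i < n \<Longrightarrow> norm (y i) \<le> c"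
  shows "norm (\<Sum>i=m..<n. (a (Suc i) - a i) *\<^sub>R y i) \<le> (a n - a m) * c"
proof -
  have "norm (\<Sum>i=m..<n. (a (Suc i) - a i) *\<^sub>R y i) \<le> (\<Sum>i=m..<n. (a (Suc i) - a i) * c)"
    using assms by (intro sum_norm_le) (simp add: mult_left_mono monoD)
  also have "\<dots> = (a n - a m) * c"
    using assms(2) by (simp add: sum_distrib_right[symmetric] sum_Suc_diff')
  finally show ?thesis .
qed

lemma le_first_index:
  assumes "filterlim a at_top sequentially"
  shows "x \<le> a (first_index a x)"
proof -
  obtain n where "x \<le> a n"
    using assms by (auto simp: filterlim_at_top eventually_sequentially)
  then show ?thesis
    unfolding first_index_def by (rule LeastI)
qed

theorem theorem3p2:
  fixes x :: "nat \<Rightarrow> 'b::real_normed_vector"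
    and a :: "nat \<Rightarrow> real"
    and \<gamma> :: "rat \<Rightarrow> nat"
    and z :: "nat \<Rightarrow> nat"
    and \<epsilon> :: rat
    and w :: nat
  assumes "0 < a 0"
    and "\<forall>n. a n \<le> a (Suc n)"
    and "filterlim a at_top sequentially"
    and "0 < \<epsilon>"
    and "\<forall>i \<le> \<gamma> (\<epsilon> / 4). norm (partial_sum x i) \<le> real (z (\<gamma> (\<epsilon> / 4)))"
    and "\<forall>n \<in> {\<gamma> (\<epsilon> / 4)..w}.
           norm (partial_sum x n - partial_sum x (\<gamma> (\<epsilon> / 4))) < real_of_rat (\<epsilon> / 4)"
  shows "\<forall>n \<in> {kronecker_rate a \<gamma> z \<epsilon>..w}.
           norm ((1 / a n) *\<^sub>R (\<Sum>i=0..n. a i *\<^sub>R x i)) < real_of_rat \<epsilon>"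
proof
  fix n
  define M where "M = \<gamma> (\<epsilon> / 4)"
  define Z where "Z = real (z M)"
  define e where "e = real_of_rat \<epsilon>"
  define s where "s = partial_sum x"
  assume "n \<in> {kronecker_rate a \<gamma> z \<epsilon>..w}"
  then have Mn: "M \<le> n" and nw: "n \<le> w" and fn: "first_index a (4 * a M * Z / e) \<le> n"
    by (simp_all add: kronecker_rate_def M_def Z_def e_def)
  have e_pos: "0 < e" using assms(4) by (simp add: e_def)
  have "mono a" using assms(2) by (simp add: mono_iff_le_Suc)
  have a_pos: "0 < a k" for k
    using assms(1) monoD[OF \<open>mono a\<close>, of 0 k] by simp
  have norm_s: "norm (s i) \<le> Z" if "i \<le> M" for i
    using assms(5) that by (simp add: s_def Z_def M_def)
  have close: "norm (s i - s M) < e / 4" if "M \<le> i" "i \<le> n" for i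
    using assms(6) that nw by (simp add: s_def e_def M_def of_rat_divide)
  have "4 * a M * Z / e \<le> a n"
    using le_first_index[OF assms(3)] monoD[OF \<open>mono a\<close> fn] by (rule order_trans)
  \<comment> \<open>The factor 4 in the rate yields a quarter here, because this product enters the
    bound on the head twice.\<close>
  then have aMZ: "a M * Z \<le> a n * (e / 4)"
    using e_pos by (simp add: field_simps)

  have "norm (\<Sum>i=0..M. a i *\<^sub>R x i)
      \<le> norm (a M *\<^sub>R s M) + norm (\<Sum>i=0..<M. (a (Suc i) - a i) *\<^sub>R s i)"
    unfolding weighted_sum_by_parts s_def by (rule norm_triangle_ineq4)
  also have "\<dots> \<le> a M * Z + (a M - a 0) * Z"
    using a_pos[of M] norm_s
    by (intro add_mono norm_sum_increments_le \<open>mono a\<close>) (simp_all add: mult_left_mono)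
  \<comment> \<open>Dropping \<open>- a 0 * Z\<close> uses that \<open>Z\<close> is nonnegative,
    being the cast of a natural number.\<close>
  also have "\<dots> \<le> 2 * (a M * Z)"
    using a_pos[of 0] by (simp add: Z_def algebra_simps)
  finally have head: "norm (\<Sum>i=0..M. a i *\<^sub>R x i) \<le> a n * (e / 2)"
    using aMZ by simp
  \<comment> \<open>Of the three bounds only this one is strict; it makes the final inequality
    strict.\<close>
  have middle: "norm (a n *\<^sub>R (s n - s M)) < a n * (e / 4)"
    using a_pos[of n] close[OF Mn order_refl] by simp
  have "norm (\<Sum>i=M..<n. (a (Suc i) - a i) *\<^sub>R (s i - s M)) \<le> (a n - a M) * (e / 4)"
    using close by (intro norm_sum_increments_le \<open>mono a\<close> Mn) (simp add: less_imp_le)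
  also have "\<dots> \<le> a n * (e / 4)"
    using a_pos[of M] e_pos by (intro mult_right_mono) simp_all
  finally have tail: "norm (\<Sum>i=M..<n. (a (Suc i) - a i) *\<^sub>R (s i - s M)) \<le> a n * (e / 4)" .

  have "norm (\<Sum>i=0..n. a i *\<^sub>R x i)
      \<le> norm (\<Sum>i=0..M. a i *\<^sub>R x i) + norm (a n *\<^sub>R (s n - s M))
        + norm (\<Sum>i=M..<n. (a (Suc i) - a i) *\<^sub>R (s i - s M))"
    unfolding weighted_sum_by_parts_from[OF Mn] s_def
    by (rule order_trans[OF norm_triangle_ineq4 add_right_mono[OF norm_triangle_ineq]])
  \<comment> \<open>The shares of \<open>a n * e\<close> are a half for the head and a quarter for
    each of the other two terms.\<close>
  also have "\<dots> < a n * e"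
    using head middle tail by simp
  finally show "norm ((1 / a n) *\<^sub>R (\<Sum>i=0..n. a i *\<^sub>R x i)) < real_of_rat \<epsilon>"
    using a_pos[of n] by (simp add: e_def field_simps)
qed

end
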